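(* Let $N\geq 3$ be an integer. Then there exists a set $A\subseteq \mathbb{N}$ such that $R_2(A,n)=R_2(\mathbb{N}\setminus A,n)$ for all integers $n\geq 2N-1$, $|A\cap A_0|=+\infty$, $|A\cap B_0|=+\infty$, and $$R_2(A,3N-1)=0.$$
   Context: $\mathbb{N}$ denotes the set of nonnegative integers (including $0$). For $A\subseteq\mathbb{N}$ and an integer $n$, $R_2(A,n)$ denotes the number of solutions of $n=a+a'$ with $a,a'\in A$ and $a<a'$. For $a\in\mathbb{N}$, $D(a)$ is the number of ones in the binary representation of $a$ (with $D(0)=0$). $A_0$ is the set of all $a\in\mathbb{N}$ with $D(a)$ even (the Thue–Morse set), and $B_0=\mathbb{N}\setminus A_0$. *)

theory Defs
  imports Main
begin

definition R2 :: "nat set \<Rightarrow> int \<Rightarrow> nat" where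
  "R2 A n = card {(a, a'). a \<in> A \<and> a' \<in> A \<and> a < a' \<and> n = int a + int a'}"

definition D :: "nat \<Rightarrow> nat" where
  "D a = card {i. bit a i}"

definition A0 :: "nat set" where
  "A0 = {a. even (D a)}"

definition B0 :: "nat set" where
  "B0 = UNIV - A0"

end

(*
  Write e(a) = 1 for a in A and e(a) = -1 otherwise.  Pairing a with n - a gives
    2 (R2 A n - R2 (- A) n) = (sum of e(i) over i <= n, 2 i <> n).
  If e(2 m) = e(m) and e(2 m + 1) = - e(m) for all m >= M and the sum of e over [0, 2 M) is 0,
  then the right-hand side vanishes for all n >= 2 M - 1.  The membership of the integers in
  [M, 2 M) determines A on [M, oo) through these relations.  Choose it so that exactly one of
  m, 3 M - 1 - m belongs to A (unless they coincide), and let i < M belong to A iff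
  3 M - 1 - i does not.  Then no two distinct elements of A, and no two distinct elements of
  its complement, have the sum 3 M - 1, and the pairing identity at n = 3 M - 1 shows that e
  sums to 0 over [0, 2 M).  The free choice is made so that A agrees with the Thue-Morse set
  at one of M, M + 1 and disagrees at the other; the relations propagate both behaviours to
  infinitely many elements.
*)
theory Submission
  imports Defs
begin

definition memsgn :: "nat set \<Rightarrow> nat \<Rightarrow> int" where
  "memsgn A a = (if a \<in> A then 1 else -1)"

lemma finite_bits_nat: "finite {i. bit (m::nat) i}"
proof (rule finite_subset)
  show "{i. bit m i} \<subseteq> {..<m}"
  proof
    fix i assume "i \<in> {i. bit m i}"
    then have "odd (m div 2 ^ i)" by (simp add: bit_iff_odd)
    then have "2 ^ i \<le> m" by (metis div_less even_zero not_le)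
    then show "i \<in> {..<m}" using less_le_trans[OF less_exp] by simp
  qed
qed simp

lemma D_double: "D (2 * m) = D m"
proof -
  have "{i. bit (2 * m) i} = Suc ` {i. bit m i}"
    by (auto simp: bit_double_iff image_iff gr0_conv_Suc)
  then show ?thesis by (simp add: D_def card_image)
qed

lemma D_Suc_double: "D (Suc (2 * m)) = Suc (D m)"
proof -
  have "bit (Suc (2 * m)) i \<longleftrightarrow> i = 0 \<or> (\<exists>j. i = Suc j \<and> bit m j)" for i
    by (cases i) (simp_all add: bit_0 bit_Suc)
  then have "{i. bit (Suc (2 * m)) i} = insert 0 (Suc ` {i. bit m i})"
    by auto
  then show ?thesis
    by (simp add: D_def card_image finite_bits_nat)
qed

lemma R2_eq_card: "R2 A (int n) = card {a. 2 * a < n \<and> a \<in> A \<and> n - a \<in> A}"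
proof -
  have "{(a, a'). a \<in> A \<and> a' \<in> A \<and> a < a' \<and> int n = int a + int a'}
      = (\<lambda>a. (a, n - a)) ` {a. 2 * a < n \<and> a \<in> A \<and> n - a \<in> A}"
    (is "?L = ?R")
  proof
    show "?L \<subseteq> ?R"
    proof clarify
      fix a a' assume a: "a \<in> A" "a' \<in> A" "a < a'" "int n = int a + int a'"
      then have "a' = n - a" "2 * a < n" by linarith+
      with a show "(a, a') \<in> ?R" by auto
    qed
  qed auto
  moreover have "inj_on (\<lambda>a. (a, n - a)) S" for S
    by (auto simp: inj_on_def)
  ultimately show ?thesis
    by (simp add: R2_def card_image)
qed

lemma R2_diff:
  "2 * (int (R2 A (int n)) - int (R2 (UNIV - A) (int n)))
    = (\<Sum>i\<le>n. memsgn A i) - (if even n then memsgn A (n div 2) else 0)"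
proof -
  define P where "P = {a. 2 * a < n}"
  define Q where "Q = {a. a \<le> n \<and> n < 2 * a}"
  define C where "C = {a. 2 * a = n}"
  have fin: "finite P" "finite Q" "finite C"
    unfolding P_def Q_def C_def by (rule finite_subset[of _ "{..n}"]; auto)+
  have R2_sum: "int (R2 X (int n)) = (\<Sum>a\<in>P. if a \<in> X \<and> n - a \<in> X then 1 else 0)" for X
  proof -
    have "{a. 2 * a < n \<and> a \<in> X \<and> n - a \<in> X} = {a \<in> P. a \<in> X \<and> n - a \<in> X}"
      by (auto simp: P_def)
    then show ?thesis
      using fin by (simp add: R2_eq_card sum.If_cases Int_def)
  qed
  have "2 * (int (R2 A (int n)) - int (R2 (UNIV - A) (int n)))
      = (\<Sum>a\<in>P. memsgn A a + memsgn A (n - a))"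
    \<comment> \<open>Twice the difference of the two indicators is 2, -2 or 0 according as both,
      none or exactly one of \<open>a\<close>, \<open>n - a\<close> lies in \<open>A\<close>; this
      is the sum of the two signs.\<close>
    unfolding R2_sum sum_subtractf[symmetric] sum_distrib_left
    by (intro sum.cong) (auto simp: memsgn_def)
  also have "\<dots> = (\<Sum>a\<in>P. memsgn A a) + (\<Sum>a\<in>Q. memsgn A a)"
  proof -
    have "(\<Sum>a\<in>P. memsgn A (n - a)) = (\<Sum>a\<in>Q. memsgn A a)"
      by (rule sum.reindex_bij_witness[of _ "\<lambda>a. n - a" "\<lambda>a. n - a"])
        (auto simp: P_def Q_def)
    then show ?thesis by (simp add: sum.distrib)
  qed
  also have "\<dots> = (\<Sum>i\<le>n. memsgn A i) - (\<Sum>i\<in>C. memsgn A i)"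
  proof -
    have "{..n} = (P \<union> Q) \<union> C" by (auto simp: P_def Q_def C_def)
    moreover have "P \<inter> Q = {}" "(P \<union> Q) \<inter> C = {}" by (auto simp: P_def Q_def C_def)
    ultimately show ?thesis using fin by (simp add: sum.union_disjoint)
  qed
  also have "(\<Sum>i\<in>C. memsgn A i) = (if even n then memsgn A (n div 2) else 0)"
  proof -
    have "C = (if even n then {n div 2} else {})" by (auto simp: C_def)
    then show ?thesis by simp
  qed
  finally show ?thesis .
qed

context
  fixes A :: "nat set" and M :: nat
  assumes even_mem: "\<And>m. M \<le> m \<Longrightarrow> 2 * m \<in> A \<longleftrightarrow> m \<in> A"
    and odd_mem: "\<And>m. M \<le> m \<Longrightarrow> Suc (2 * m) \<in> A \<longleftrightarrow> m \<notin> A"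
begin

lemma memsgn_double:
  assumes "M \<le> m"
  shows "memsgn A (2 * m) = memsgn A m" "memsgn A (Suc (2 * m)) = - memsgn A m"
  using even_mem[OF assms] odd_mem[OF assms] by (simp_all add: memsgn_def)

text \<open>Beyond \<open>2 * M\<close> the terms cancel in consecutive pairs \<open>2 * k\<close>,
  \<open>2 * k + 1\<close>.\<close>

lemma sum_memsgn_double:
  assumes "M \<le> m"
  shows "(\<Sum>i<2*m. memsgn A i) = (\<Sum>i<2*M. memsgn A i)"
  using assms by (induction m rule: dec_induct) (simp_all add: memsgn_double)

lemma R2_eq_R2_compl:
  assumes sum0: "(\<Sum>i<2*M. memsgn A i) = 0" and n: "2 * M - 1 \<le> n" and M: "0 < M"
  shows "R2 A (int n) = R2 (UNIV - A) (int n)"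
proof -
  have "(\<Sum>i\<le>n. memsgn A i) = (if even n then memsgn A (n div 2) else 0)"
  proof (cases "even n")
    case True
    then obtain m where m: "n = 2 * m" by (elim evenE)
    then have "M \<le> m" using n M by presburger
    then show ?thesis
      \<comment> \<open>Only the term at \<open>2 * m\<close> survives, and it has the sign of the
        midpoint \<open>m\<close>.\<close>
      using sum0 sum_memsgn_double[of m]
      by (simp add: m lessThan_Suc_atMost[symmetric] memsgn_double)
  next
    case False
    then obtain m where m: "n = 2 * m + 1" by (elim oddE)
    \<comment> \<open>The range up to \<open>n\<close> consists of \<open>m + 1\<close> full pairs,
      so \<open>M \<le> m + 1\<close> suffices; this admits the boundary case
      \<open>n = 2 * M - 1\<close>.\<close>
    then have "M \<le> Suc m" using n M by simp
    then have "(\<Sum>i<2*Suc m. memsgn A i) = 0"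
      using sum0 sum_memsgn_double by metis
    then show ?thesis
      by (simp add: m lessThan_Suc_atMost[symmetric])
  qed
  then show ?thesis using R2_diff[of A n] by simp
qed

text \<open>Both counts vanish at \<open>3 * M - 1\<close>, so \<open>R2_diff\<close> evaluates the
  sum of signs below \<open>3 * M\<close>; cancelling pairs from \<open>2 * M\<close> on brings it
  down to \<open>2 * M\<close>.\<close>

lemma R2_sum_memsgn_eq_0:
  assumes M: "0 < M"
    and anti: "\<And>i. i < 3 * M \<Longrightarrow> 2 * i \<noteq> 3 * M - 1 \<Longrightarrow> i \<in> A \<longleftrightarrow> 3 * M - 1 - i \<notin> A"
  shows "R2 A (int (3 * M - 1)) = 0" "(\<Sum>i<2*M. memsgn A i) = 0"
proof -
  have anti': "a \<in> A \<longleftrightarrow> 3 * M - 1 - a \<notin> A" if "2 * a < 3 * M - 1" for a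
    using anti[of a] that by simp
  have emp: "{a. 2 * a < 3 * M - 1 \<and> a \<in> A \<and> 3 * M - 1 - a \<in> A} = {}"
    "{a. 2 * a < 3 * M - 1 \<and> a \<in> UNIV - A \<and> 3 * M - 1 - a \<in> UNIV - A} = {}"
    using anti' by blast+
  show zero: "R2 A (int (3 * M - 1)) = 0"
    unfolding R2_eq_card emp by simp
  have "R2 (UNIV - A) (int (3 * M - 1)) = 0"
    unfolding R2_eq_card emp by simp
  with zero R2_diff[of A "3 * M - 1"]
  have total: "(\<Sum>i<3*M. memsgn A i)
      = (if even (3 * M - 1) then memsgn A ((3 * M - 1) div 2) else 0)"
    using M by (simp add: lessThan_Suc_atMost[symmetric])
  show "(\<Sum>i<2*M. memsgn A i) = 0"
  proof (cases "even M")
    case True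
    then obtain m where m: "M = 2 * m" by (elim evenE)
    have "(\<Sum>i<3*M. memsgn A i) = (\<Sum>i<2*M. memsgn A i)"
      using sum_memsgn_double[of "3 * m"] by (simp add: m)
    moreover have "odd (3 * M - 1)" using True M by simp
    ultimately show ?thesis using total by simp
  next
    case False
    then obtain m where m: "M = 2 * m + 1" by (elim oddE)
    \<comment> \<open>For odd \<open>M\<close> the last index \<open>3 * M - 1\<close> is unpaired;
      its sign is that of its half \<open>3 * m + 1\<close>, which is exactly the midpoint term in
      \<open>total\<close>.\<close>
    have 3: "3 * M = Suc (2 * (3 * m + 1))" by (simp add: m)
    have "M \<le> 3 * m + 1" by (simp add: m)
    then have "(\<Sum>i<3*M. memsgn A i) = (\<Sum>i<2*M. memsgn A i) + memsgn A (3 * m + 1)"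
      unfolding 3 lessThan_Suc using sum_memsgn_double[of "3 * m + 1"] memsgn_double[of "3 * m + 1"]
      by simp
    moreover have "even (3 * M - 1)" "(3 * M - 1) div 2 = 3 * m + 1" by (simp_all add: m)
    ultimately show ?thesis using total by simp
  qed
qed

text \<open>If \<open>m\<close> is not in \<open>A\<close>, then \<open>2 * m + 1\<close> is, and
  its digit sum has the other parity. Doubling preserves both membership and digit sum, so one
  suitable element yields infinitely many.\<close>

lemma infinite_mem_parity_D:
  assumes M: "0 < M" and m: "M \<le> m" "m \<in> A \<longleftrightarrow> even (D m) = b"
  shows "infinite {a \<in> A. even (D a) = b}"
proof -
  obtain k where k: "M \<le> k" "k \<in> A" "even (D k) = b"
  proof (cases "m \<in> A")
    case True
    then show ?thesis using m that[of m] by simp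
  next
    case False
    then show ?thesis
      using m odd_mem[of m] that[of "Suc (2 * m)"] by (auto simp: D_Suc_double)
  qed
  have "k * 2 ^ j \<in> A \<and> D (k * 2 ^ j) = D k" for j
  proof (induction j)
    case (Suc j)
    have "M \<le> k * 2 ^ j" using k(1) by (simp add: trans_le_add1 le_trans[of M k])
    then show ?case
      using Suc even_mem[of "k * 2 ^ j"] D_double[of "k * 2 ^ j"] by (simp add: mult.left_commute)
  qed (use k in simp)
  then have "range (\<lambda>j. k * 2 ^ j) \<subseteq> {a \<in> A. even (D a) = b}"
    using k by auto
  moreover have "infinite (range (\<lambda>j. k * 2 ^ j))"
    using k M by (intro notI) (auto dest!: finite_imageD simp: inj_on_def)
  ultimately show ?thesis by (rule infinite_super)
qed

end

text \<open>On the lower half of [M, 2M) this is the Thue-Morse rule twisted by the parity of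
  \<open>m\<close>: agreement at even \<open>m\<close>, disagreement at odd \<open>m\<close>. The
  upper half is the negated reflection.\<close>

definition seed :: "nat \<Rightarrow> nat \<Rightarrow> bool" where
  "seed M m = (if 2 * m < 3 * M then even (m + D m)
     else odd (3 * M - 1 - m + D (3 * M - 1 - m)))"

text \<open>The disjunct \<open>m = 0\<close> secures termination when \<open>M = 0\<close>.\<close>

function extend :: "nat \<Rightarrow> nat \<Rightarrow> bool" where
  "extend M m = (if m < 2 * M \<or> m = 0 then seed M m else extend M (m div 2) = even m)"
  by auto
termination by (relation "measure snd") auto

declare extend.simps [simp del]

text \<open>For \<open>m < M\<close> the reflected point lies in [2M, 3M), so its membership is
  already fixed by \<open>extend\<close>.\<close>

definition witness :: "nat \<Rightarrow> nat set" where
  "witness M = {m. if m < M then \<not> extend M (3 * M - 1 - m) else extend M m}"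

lemma witness_double:
  assumes "0 < M" "M \<le> m"
  shows "2 * m \<in> witness M \<longleftrightarrow> m \<in> witness M"
    "Suc (2 * m) \<in> witness M \<longleftrightarrow> m \<notin> witness M"
  using assms extend.simps[of M "2 * m"] extend.simps[of M "Suc (2 * m)"]
  by (auto simp: witness_def)

lemma mem_witness_seed: "M \<le> m \<Longrightarrow> m < 2 * M \<Longrightarrow> m \<in> witness M \<longleftrightarrow> seed M m"
  by (simp add: witness_def extend.simps)

lemma witness_antisym:
  assumes "i < 3 * M" "2 * i \<noteq> 3 * M - 1"
  shows "i \<in> witness M \<longleftrightarrow> 3 * M - 1 - i \<notin> witness M"
proof -
  have less: "i \<in> witness M \<longleftrightarrow> 3 * M - 1 - i \<notin> witness M" if i: "2 * i < 3 * M - 1" for i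
  proof (cases "i < M")
    case True
    then show ?thesis by (simp add: witness_def)
  next
    \<comment> \<open>Here \<open>i\<close> and its reflection both lie in [M, 2M), on opposite
      sides of the split in \<open>seed\<close>.\<close>
    case False
    then have "3 * M - 1 - (3 * M - 1 - i) = i" "\<not> 2 * (3 * M - 1 - i) < 3 * M"
      "M \<le> 3 * M - 1 - i" "3 * M - 1 - i < 2 * M" "M \<le> i" "i < 2 * M" "2 * i < 3 * M"
      using i by linarith+
    then show ?thesis by (simp add: mem_witness_seed seed_def)
  qed
  show ?thesis
  proof (cases "2 * i < 3 * M - 1")
    case True
    then show ?thesis by (rule less)
  next
    case False
    have "2 * (3 * M - 1 - i) < 3 * M - 1" "3 * M - 1 - (3 * M - 1 - i) = i"
      using False assms by linarith+
    then show ?thesis using less[of "3 * M - 1 - i"] by auto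
  qed
qed

theorem theorem3:
  fixes N :: int
  assumes "N \<ge> 3"
  shows "\<exists>A :: nat set.
    (\<forall>n :: int. n \<ge> 2 * N - 1 \<longrightarrow> R2 A n = R2 (UNIV - A) n) \<and>
    infinite (A \<inter> A0) \<and> infinite (A \<inter> B0) \<and>
    R2 A (3 * N - 1) = 0"
proof -
  define M where "M = nat N"
  have M: "3 \<le> M" "0 < M" and N: "N = int M" using assms by (auto simp: M_def)
  note dbl = witness_double[OF M(2)]
  note zero = R2_sum_memsgn_eq_0[of M "witness M", OF dbl M(2) witness_antisym]
  have R2_eq: "R2 (witness M) n = R2 (UNIV - witness M) n" if "2 * N - 1 \<le> n" for n
    using R2_eq_R2_compl[of M "witness M" "nat n", OF dbl zero(2)] that M N by simp
  have R2_0: "R2 (witness M) (3 * N - 1) = 0"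
    using zero(1) M by (simp add: N of_nat_diff)
  \<comment> \<open>This is where \<open>3 \<le> M\<close> enters:
    \<open>2 * (M + 1) < 3 * M\<close> puts \<open>M + 1\<close> in the lower half of the
    seed.\<close>
  have low: "m \<in> witness M \<longleftrightarrow> even (m + D m)" if "m \<in> {M, Suc M}" for m
    using that M mem_witness_seed[of M m] by (auto simp: seed_def)
  have inf: "infinite {a \<in> witness M. even (D a) = b}" for b
  proof -
    \<comment> \<open>The parity of \<open>m\<close> decides agreement with Thue-Morse, and
      consecutive integers supply both parities.\<close>
    have "\<exists>m \<in> {M, Suc M}. even m = b" by auto
    then obtain m where m: "m \<in> {M, Suc M}" "even m = b" by blast
    then have "m \<in> witness M \<longleftrightarrow> even (D m) = b" using low[of m] by auto
    then show ?thesis using m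
      by (intro infinite_mem_parity_D[of M "witness M" m, OF dbl]) (use M in auto)
  qed
  have "witness M \<inter> A0 = {a \<in> witness M. even (D a) = True}"
    "witness M \<inter> B0 = {a \<in> witness M. even (D a) = False}"
    by (auto simp: A0_def B0_def)
  then have "infinite (witness M \<inter> A0)" "infinite (witness M \<inter> B0)"
    using inf[of True] inf[of False] by simp_all
  then show ?thesis using R2_eq R2_0 by blast
qed

end
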